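(* The tangent developable constant angle surfaces are generated by cylindrical helices. That is, let $\alpha:I\subset\mathbb{R}\to\mathbb{R}^3$ be a smooth curve parameterized by arc length, with nonvanishing curvature and unit tangent $t=\alpha'$, and let $M$ be the tangent developable surface $$r(s,v)=\alpha(s)+v\,t(s),$$ considered away from the points of $\alpha$. If $M$ is a constant angle surface, then its generating curve $\alpha$ is a cylindrical helix.
   Context: $I$ is an interval. The surface $M$ is oriented and is smooth except at the points of $\alpha$ ($v=0$), which is its edge of regression. Constant angle surface: a surface in $\mathbb{R}^3$ whose unit normal $N$ makes a constant angle $\theta\in[0,\pi)$ with a fixed direction $k$ at every point, i.e. $\langle N,k\rangle=\cos\theta$ with $k$ a unit vector. Without loss of generality the Cartesian coordinates are chosen so that $k$ is the direction of the third axis. Cylindrical helix (also called generalized helix or slope line): a curve that, in suitable Cartesian coordinates, can be parameterized by $$\alpha(s)=\left(\frac{a}{c}\int\sin\lambda(s)\,ds,\ \frac{a}{c}\int\cos\lambda(s)\,ds,\ \frac{b}{c}\,s\right),$$ where $a,b,c\in(0,\infty)$ satisfy $a^2+b^2=c^2$, $\lambda:I\subset\mathbb{R}\to\mathbb{R}$ is a smooth function, and the integrals denote antiderivatives.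
   Formalization: The formal theorem assumes in addition that the tangent developable M does not lie in a plane: for a plane curve with nonvanishing curvature (e.g. a circle) M has constant normal, hence constant angle, yet α is not a cylindrical helix, since b > 0 is required. *)

theory Defs
  imports "HOL-Analysis.Analysis"
begin

text \<open>Smoothness of class \<open>C\<^sup>\<infinity>\<close> on an interval, with one-sided derivatives at those endpoints
  that belong to the interval; \<open>D n\<close> is the \<open>n\<close>-th derivative.\<close>

definition smooth_curve_on :: "real set \<Rightarrow> (real \<Rightarrow> 'a::real_normed_vector) \<Rightarrow> bool" where
  "smooth_curve_on I f \<longleftrightarrow>
     (\<exists>D. D 0 = f \<and>
          (\<forall>n. \<forall>s\<in>I. (D n has_vector_derivative D (Suc n) s) (at s within I)))"

definition tangent_vec :: "real set \<Rightarrow> (real \<Rightarrow> real^3) \<Rightarrow> real \<Rightarrow> real^3" where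
  "tangent_vec I \<alpha> s = vector_derivative \<alpha> (at s within I)"

definition arc_length_param_on :: "real set \<Rightarrow> (real \<Rightarrow> real^3) \<Rightarrow> bool" where
  "arc_length_param_on I \<alpha> \<longleftrightarrow> (\<forall>s\<in>I. norm (tangent_vec I \<alpha> s) = 1)"

text \<open>This is the curvature only for curves parameterized by arc length.\<close>

definition curvature :: "real set \<Rightarrow> (real \<Rightarrow> real^3) \<Rightarrow> real \<Rightarrow> real" where
  "curvature I \<alpha> s = norm (vector_derivative (tangent_vec I \<alpha>) (at s within I))"

text \<open>Surfaces are parameterized: \<open>D\<close> is the parameter domain and \<open>r\<close> the parameterization.\<close>

definition partial_1 :: "(real \<times> real) set \<Rightarrow> (real \<times> real \<Rightarrow> real^3) \<Rightarrow> real \<times> real \<Rightarrow> real^3" where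
  "partial_1 D r p =
     vector_derivative (\<lambda>s. r (s, snd p)) (at (fst p) within {s. (s, snd p) \<in> D})"

definition partial_2 :: "(real \<times> real) set \<Rightarrow> (real \<times> real \<Rightarrow> real^3) \<Rightarrow> real \<times> real \<Rightarrow> real^3" where
  "partial_2 D r p =
     vector_derivative (\<lambda>v. r (fst p, v)) (at (snd p) within {v. (fst p, v) \<in> D})"

text \<open>An orientation is a continuous unit normal field along the parameterization.  If \<open>D\<close> is
  disconnected, the orientation may be chosen independently on each component.\<close>

definition unit_normal_field ::
  "(real \<times> real) set \<Rightarrow> (real \<times> real \<Rightarrow> real^3) \<Rightarrow> (real \<times> real \<Rightarrow> real^3) \<Rightarrow> bool" where
  "unit_normal_field D r N \<longleftrightarrow>
     continuous_on D N \<and>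
     (\<forall>p\<in>D. norm (N p) = 1 \<and> N p \<bullet> partial_1 D r p = 0 \<and> N p \<bullet> partial_2 D r p = 0)"

definition constant_angle_surface ::
  "(real \<times> real) set \<Rightarrow> (real \<times> real \<Rightarrow> real^3) \<Rightarrow> bool" where
  "constant_angle_surface D r \<longleftrightarrow>
     (\<forall>p\<in>D. cross3 (partial_1 D r p) (partial_2 D r p) \<noteq> 0) \<and>
     (\<exists>N k \<theta>. unit_normal_field D r N \<and> norm k = 1 \<and> 0 \<le> \<theta> \<and> \<theta> < pi \<and>
               (\<forall>p\<in>D. N p \<bullet> k = cos \<theta>))"

definition tangent_developable ::
  "real set \<Rightarrow> (real \<Rightarrow> real^3) \<Rightarrow> real \<times> real \<Rightarrow> real^3" where
  "tangent_developable I \<alpha> = (\<lambda>(s, v). \<alpha> s + v *\<^sub>R tangent_vec I \<alpha> s)"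

text \<open>Both sheets of the tangent developable, without the curve itself (\<open>v = 0\<close>).\<close>

definition off_edge :: "real set \<Rightarrow> (real \<times> real) set" where
  "off_edge I = I \<times> {v. v \<noteq> 0}"

text \<open>The suitable Cartesian coordinate system has origin \<open>q\<close> and axes given by the images under
  \<open>A\<close> of the standard basis.  \<open>X\<close> and \<open>Y\<close> are the antiderivatives of \<open>sin \<circ> lam\<close> and
  \<open>cos \<circ> lam\<close>.\<close>

definition cylindrical_helix :: "real set \<Rightarrow> (real \<Rightarrow> real^3) \<Rightarrow> bool" where
  "cylindrical_helix I \<alpha> \<longleftrightarrow>
     (\<exists>a b c :: real. \<exists>lam X Y :: real \<Rightarrow> real. \<exists>(A :: real^3 \<Rightarrow> real^3) (q :: real^3).
        a > 0 \<and> b > 0 \<and> c > 0 \<and> a\<^sup>2 + b\<^sup>2 = c\<^sup>2 \<and>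
        smooth_curve_on I lam \<and>
        (\<forall>s\<in>I. (X has_real_derivative sin (lam s)) (at s within I)) \<and>
        (\<forall>s\<in>I. (Y has_real_derivative cos (lam s)) (at s within I)) \<and>
        orthogonal_transformation A \<and>
        (\<forall>s\<in>I. \<alpha> s = q + A (vector [a / c * X s, a / c * Y s, b / c * s])))"

end

theory Submission
  imports Defs
begin

text \<open>Along a ruling the tangent plane of the tangent developable does not change: at every
  point of the ruling through \<open>\<alpha> s\<close> it is spanned by \<open>T = \<alpha>'\<close> and \<open>U = \<alpha>''\<close>. Hence it suffices
  to look at the normal \<open>B\<close> along the single curve \<open>v = 1\<close>; up to a sign, which connectedness of
  the interval makes constant, \<open>B\<close> is the binormal of \<open>\<alpha>\<close>. In particular it is differentiable
  (lemma \<open>unit_normal_differentiable\<close>).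

  Because \<open>B\<close> has unit length and is orthogonal to \<open>T\<close> and \<open>U\<close>, its derivative is \<open>\<mu> U\<close> for a
  function \<open>\<mu>\<close>, which up to sign is the torsion divided by the curvature. The constant angle
  condition gives \<open>\<mu> \<langle>U, k\<rangle> = 0\<close>. Were the torsion nowhere zero, this would say at once
  that \<open>\<langle>T, k\<rangle>\<close> is constant, that is, that \<open>\<alpha>\<close> has constant slope. The difficulty is a torsion
  that vanishes at some points only, where the condition says nothing about \<open>\<langle>U, k\<rangle>\<close>. It is
  resolved in lemma \<open>constant_angle_dichotomy\<close>: where \<open>\<mu> \<noteq> 0\<close>, also the derivative of \<open>\<langle>U, k\<rangle>\<close>
  vanishes, and this forces \<open>\<mu>\<^sup>2 = 1 / q\<^sup>2 - 1\<close> with \<open>q = \<langle>B, k\<rangle>\<close>. So the continuous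
  function \<open>\<mu>\<close> has at most three values and is constant. If it is 0, the binormal is constant and
  the surface lies in a plane; otherwise the slope is constant.

  A curve of constant slope is then put into the normal form of a cylindrical helix by
  rotating \<open>k\<close> to the third axis. The projection of \<open>T\<close> to the first two coordinates moves on a
  circle, and \<open>\<lambda>\<close> is its polar angle, measured from the second axis
  (lemma \<open>smooth_angle_function\<close>).\<close>

section \<open>Calculus on an interval\<close>

lemma interval_at_within_neq_bot:
  fixes I :: "real set"
  assumes "is_interval I" "\<exists>x\<in>I. \<exists>y\<in>I. x < y" "s \<in> I"
  shows "at s within I \<noteq> bot"
proof -
  have "s islimpt I"
    using assms by (intro connected_imp_perfect) (auto simp: is_interval_connected_1)
  then show ?thesis by (simp add: trivial_limit_within)
qed

lemma derivative_of_constant: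
  fixes I :: "real set"
  assumes "is_interval I" "\<exists>x\<in>I. \<exists>y\<in>I. x < y" "s \<in> I"
    and f: "(f has_vector_derivative f') (at s within I)"
    and const: "\<And>x. x \<in> I \<Longrightarrow> f x = c"
  shows "f' = 0"
proof -
  have "(f has_vector_derivative 0) (at s within I)"
    using \<open>s \<in> I\<close> const by (rule has_vector_derivative_transform) auto
  then show ?thesis
    using vector_derivative_unique_within[OF interval_at_within_neq_bot f] assms by blast
qed

text \<open>The interval may be open, half-open or closed at either end. The fundamental theorem is
  applied on a compact subinterval that agrees with \<open>I\<close> near the given point, so that one-sided
  derivatives arise exactly at the endpoints that belong to \<open>I\<close>.\<close>

lemma antiderivative_on_interval:
  fixes I :: "real set" and g :: "real \<Rightarrow> real"
  assumes I: "is_interval I" and "c \<in> I" and g: "continuous_on I g"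
  obtains G where "G c = 0"
    "\<And>s. s \<in> I \<Longrightarrow> (G has_vector_derivative g s) (at s within I)"
proof -
  define G :: "real \<Rightarrow> real" where "G = (\<lambda>u. LBINT y=c..u. g y)"
  have "(G has_vector_derivative g x) (at x within I)" if x: "x \<in> I" for x
  proof -
    obtain a where a: "a \<in> I" "a \<le> c" "a \<le> x" "a < x \<or> (\<forall>y\<in>I. x \<le> y)"
    proof (cases "\<exists>y\<in>I. y < x")
      case True
      then obtain y where "y \<in> I" "y < x" by blast
      then show thesis using that[of "min y c"] \<open>c \<in> I\<close> by (auto simp: min_def)
    next
      case False
      then show thesis using that[of x] x \<open>c \<in> I\<close> by force
    qed
    obtain b where b: "b \<in> I" "c \<le> b" "x \<le> b" "x < b \<or> (\<forall>y\<in>I. y \<le> x)"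
    proof (cases "\<exists>y\<in>I. x < y")
      case True
      then obtain y where "y \<in> I" "x < y" by blast
      then show thesis using that[of "max y c"] \<open>c \<in> I\<close> by (auto simp: max_def)
    next
      case False
      then show thesis using that[of x] x \<open>c \<in> I\<close> by force
    qed
    have sub: "{a..b} \<subseteq> I"
      using I a(1) b(1) unfolding is_interval_1 by fastforce
    have "(G has_vector_derivative g x) (at x within {a..b})"
      unfolding G_def using a b continuous_on_subset[OF g sub]
      by (intro interval_integral_FTC2) auto
    moreover have "at x within {a..b} = at x within I"
    proof (rule at_within_nhd)
      let ?S = "{(if a < x then a else x - 1)<..<(if x < b then b else x + 1)}"
      show "x \<in> ?S" "open ?S" by auto
      show "{a..b} \<inter> ?S - {x} = I \<inter> ?S - {x}"
        using sub a b by (auto split: if_splits intro: antisym)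
    qed
    ultimately show ?thesis by simp
  qed
  moreover have "G c = 0" by (simp add: G_def)
  ultimately show thesis using that by blast
qed

section \<open>Closure properties of smooth functions\<close>

text \<open>To see that a function is smooth it suffices to find a class of functions that contains it and
  is closed under differentiation.\<close>

lemma smooth_curve_on_coinduct:
  assumes "P f"
    and step: "\<And>h. P h \<Longrightarrow> \<exists>h'. P h' \<and> (\<forall>s\<in>I. (h has_vector_derivative h' s) (at s within I))"
  shows "smooth_curve_on I f"
proof -
  obtain E where E: "\<And>h. P h \<Longrightarrow> P (E h) \<and> (\<forall>s\<in>I. (h has_vector_derivative E h s) (at s within I))"
    using step by metis
  have P: "P ((E ^^ n) f)" for n
    by (induction n) (use \<open>P f\<close> E in auto)
  show ?thesis
    unfolding smooth_curve_on_def
    by (rule exI[of _ "\<lambda>n. (E ^^ n) f"]) (use E P in auto)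
qed

lemma smooth_curve_on_derivative:
  assumes "smooth_curve_on I f"
  obtains f' where "smooth_curve_on I f'"
    "\<And>s. s \<in> I \<Longrightarrow> (f has_vector_derivative f' s) (at s within I)"
proof -
  obtain D where D: "D 0 = f" "\<And>n s. s \<in> I \<Longrightarrow> (D n has_vector_derivative D (Suc n) s) (at s within I)"
    using assms unfolding smooth_curve_on_def by blast
  show thesis
  proof
    show "smooth_curve_on I (D 1)"
      unfolding smooth_curve_on_def by (rule exI[of _ "\<lambda>n. D (Suc n)"]) (use D in auto)
  qed (use D(2)[of _ 0] D(1) in auto)
qed

lemma smooth_curve_on_antiderivative:
  assumes "smooth_curve_on I f'"
    and "\<And>s. s \<in> I \<Longrightarrow> (f has_vector_derivative f' s) (at s within I)"
  shows "smooth_curve_on I f"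
proof -
  obtain D where D: "D 0 = f'" "\<And>n s. s \<in> I \<Longrightarrow> (D n has_vector_derivative D (Suc n) s) (at s within I)"
    using assms unfolding smooth_curve_on_def by blast
  show ?thesis
    unfolding smooth_curve_on_def
    by (rule exI[of _ "case_nat f D"]) (use D assms(2) in \<open>auto split: nat.split\<close>)
qed

lemma smooth_curve_on_continuous: "smooth_curve_on I f \<Longrightarrow> continuous_on I f"
  by (metis smooth_curve_on_derivative continuous_on_eq_continuous_within
      has_vector_derivative_continuous)

lemma smooth_curve_on_linear:
  assumes "bounded_linear L" "smooth_curve_on I f"
  shows "smooth_curve_on I (\<lambda>s. L (f s))"
proof -
  obtain D where D: "D 0 = f" "\<And>n s. s \<in> I \<Longrightarrow> (D n has_vector_derivative D (Suc n) s) (at s within I)"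
    using assms unfolding smooth_curve_on_def by blast
  show ?thesis
    unfolding smooth_curve_on_def
    by (rule exI[of _ "\<lambda>n s. L (D n s)"])
       (use D bounded_linear.has_vector_derivative[OF assms(1)] in auto)
qed

text \<open>The derivative of a sum of products is again a sum of products; this is what makes the
  class of these sums suitable for coinduction, whereas single products would require the
  Leibniz formula.\<close>

inductive sum_of_products :: "real set \<Rightarrow> (real \<Rightarrow> real) \<Rightarrow> bool" for I where
  product: "smooth_curve_on I f \<Longrightarrow> smooth_curve_on I g \<Longrightarrow> sum_of_products I (\<lambda>s. f s * g s)"
| sum: "sum_of_products I f \<Longrightarrow> sum_of_products I g \<Longrightarrow> sum_of_products I (\<lambda>s. f s + g s)"

lemma sum_of_products_smooth:
  assumes "sum_of_products I h"
  shows "smooth_curve_on I h"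
proof (rule smooth_curve_on_coinduct)
  show "sum_of_products I h" by fact
  fix h assume "sum_of_products I h"
  then show "\<exists>h'. sum_of_products I h' \<and> (\<forall>s\<in>I. (h has_vector_derivative h' s) (at s within I))"
  proof induction
    case (product f g)
    obtain f' where f': "smooth_curve_on I f'"
        "\<And>s. s \<in> I \<Longrightarrow> (f has_vector_derivative f' s) (at s within I)"
      using smooth_curve_on_derivative[OF product(1)] by blast
    obtain g' where g': "smooth_curve_on I g'"
        "\<And>s. s \<in> I \<Longrightarrow> (g has_vector_derivative g' s) (at s within I)"
      using smooth_curve_on_derivative[OF product(2)] by blast
    have "sum_of_products I (\<lambda>s. f s * g' s + f' s * g s)"
      by (rule sum_of_products.sum[OF sum_of_products.product[OF product(1) g'(1)]
            sum_of_products.product[OF f'(1) product(2)]])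
    then show ?case
      by (intro exI[of _ "\<lambda>s. f s * g' s + f' s * g s"] conjI ballI
          has_vector_derivative_mult f'(2) g'(2))
  next
    case (sum f g)
    obtain f' where f': "sum_of_products I f'"
        "\<And>s. s \<in> I \<Longrightarrow> (f has_vector_derivative f' s) (at s within I)"
      using sum.IH(1) by blast
    obtain g' where g': "sum_of_products I g'"
        "\<And>s. s \<in> I \<Longrightarrow> (g has_vector_derivative g' s) (at s within I)"
      using sum.IH(2) by blast
    show ?case
      by (intro exI[of _ "\<lambda>s. f' s + g' s"] conjI ballI sum_of_products.sum
          has_vector_derivative_add f' g')
  qed
qed

text \<open>A smooth plane curve on the unit circle has a smooth polar angle. The angle must have
  derivative \<open>x'y - xy'\<close>, so it is obtained by integration; with the right initial value,
  \<open>x sin \<lambda> + y cos \<lambda>\<close> is constantly 1, and two unit vectors with inner product 1 agree.\<close>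

lemma smooth_angle_function:
  fixes I :: "real set" and x y :: "real \<Rightarrow> real"
  assumes I: "is_interval I" "\<exists>x\<in>I. \<exists>y\<in>I. x < y"
    and x: "smooth_curve_on I x" and y: "smooth_curve_on I y"
    and circle: "\<And>s. s \<in> I \<Longrightarrow> (x s)\<^sup>2 + (y s)\<^sup>2 = 1"
  obtains lam where "smooth_curve_on I lam"
    "\<And>s. s \<in> I \<Longrightarrow> sin (lam s) = x s" "\<And>s. s \<in> I \<Longrightarrow> cos (lam s) = y s"
proof -
  obtain x' where x': "smooth_curve_on I x'"
      "\<And>s. s \<in> I \<Longrightarrow> (x has_vector_derivative x' s) (at s within I)"
    using smooth_curve_on_derivative[OF x] by blast
  obtain y' where y': "smooth_curve_on I y'"
      "\<And>s. s \<in> I \<Longrightarrow> (y has_vector_derivative y' s) (at s within I)"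
    using smooth_curve_on_derivative[OF y] by blast
  \<comment> \<open>The difference \<open>x'y - xy'\<close>, written as a sum of products.\<close>
  define g where "g = (\<lambda>s. x' s * y s + (- x s) * y' s)"
  have g: "smooth_curve_on I g"
    unfolding g_def
    by (rule sum_of_products_smooth[OF sum_of_products.sum[OF
          sum_of_products.product[OF x'(1) y] sum_of_products.product[OF _ y'(1)]]])
       (rule smooth_curve_on_linear[OF bounded_linear_minus[OF bounded_linear_ident] x])
  obtain c where c: "c \<in> I" using I(2) by blast
  obtain G where G: "G c = 0" "\<And>s. s \<in> I \<Longrightarrow> (G has_vector_derivative g s) (at s within I)"
    using antiderivative_on_interval[OF I(1) c smooth_curve_on_continuous[OF g]] by blast
  obtain l0 where l0: "y c = cos l0" "x c = sin l0"
    using sincos_total_2pi[of "y c" "x c"] circle[OF c] by (metis add.commute)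
  define lam where "lam = (\<lambda>s. G s + l0)"
  have lam': "(lam has_vector_derivative g s) (at s within I)" if "s \<in> I" for s
    unfolding lam_def using G(2)[OF that] by (auto intro!: derivative_eq_intros)
  have perp: "x s * x' s + y s * y' s = 0" if "s \<in> I" for s
  proof -
    have "((\<lambda>s. (x s)\<^sup>2 + (y s)\<^sup>2) has_vector_derivative 2 * (x s * x' s + y s * y' s)) (at s within I)"
      using x'(2)[OF that] y'(2)[OF that]
      unfolding has_real_derivative_iff_has_vector_derivative[symmetric]
      by (auto intro!: derivative_eq_intros simp: algebra_simps)
    from derivative_of_constant[OF I that this circle] show ?thesis by simp
  qed
  have "((\<lambda>s. x s * sin (lam s) + y s * cos (lam s)) has_vector_derivative 0) (at s within I)"
    if "s \<in> I" for s
  proof -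
    have "((\<lambda>s. x s * sin (lam s) + y s * cos (lam s)) has_vector_derivative
        (x' s - g s * y s) * sin (lam s) + (y' s + g s * x s) * cos (lam s)) (at s within I)"
      using x'(2)[OF that] y'(2)[OF that] lam'[OF that]
      unfolding has_real_derivative_iff_has_vector_derivative[symmetric]
      by (auto intro!: derivative_eq_intros simp: algebra_simps)
    moreover have "x' s - g s * y s = 0" "y' s + g s * x s = 0"
      unfolding g_def using perp[OF that] circle[OF that] by algebra+
    ultimately show ?thesis by simp
  qed
  from has_vector_derivative_zero_constant[OF is_interval_convex[OF I(1)] this]
  obtain d where d: "\<And>s. s \<in> I \<Longrightarrow> x s * sin (lam s) + y s * cos (lam s) = d"
    by blast
  have "lam c = l0" by (simp add: lam_def G)
  then have "d = 1"
    using d[OF c] l0 by (simp add: power2_eq_square[symmetric])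
  have *: "(x s - sin (lam s))\<^sup>2 + (y s - cos (lam s))\<^sup>2 = 0" if "s \<in> I" for s
    using d[OF that] \<open>d = 1\<close> circle[OF that] sin_cos_squared_add[of "lam s"] by algebra
  show thesis
  proof
    show "smooth_curve_on I lam"
      using g lam' by (rule smooth_curve_on_antiderivative)
  qed (use * in \<open>auto simp: sum_power2_eq_zero_iff\<close>)
qed

section \<open>Curves of constant slope\<close>

text \<open>The part of the unit tangent orthogonal to \<open>k\<close> has length \<open>a = sqrt (1 - p\<^sup>2)\<close>, so the
  helix has the parameters \<open>a\<close>, \<open>b = p\<close> and \<open>c = 1\<close>. The antiderivatives that the normal form
  requires are the rescaled coordinates of the curve itself.\<close>

lemma constant_slope_positive_imp_cylindrical_helix:
  fixes I :: "real set" and \<alpha> :: "real \<Rightarrow> real^3"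
  assumes I: "is_interval I" "\<exists>x\<in>I. \<exists>y\<in>I. x < y"
    and T: "smooth_curve_on I T"
    and \<alpha>: "\<And>s. s \<in> I \<Longrightarrow> (\<alpha> has_vector_derivative T s) (at s within I)"
    and unit: "\<And>s. s \<in> I \<Longrightarrow> norm (T s) = 1"
    and k: "norm k = 1" and p: "0 < p" "p < 1"
    and slope: "\<And>s. s \<in> I \<Longrightarrow> T s \<bullet> k = p"
  shows "cylindrical_helix I \<alpha>"
proof -
  obtain R :: "real^3 \<Rightarrow> real^3" where R: "orthogonal_transformation R" "R k = axis 3 1"
    by (rule orthogonal_transformation_exists[of k "axis 3 1"]) (simp add: k)
  have R_lin: "bounded_linear R"
    using R(1) orthogonal_transformation_linear linear_conv_bounded_linear by blast
  have comp_lin: "bounded_linear (\<lambda>v. R v $ i)" for i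
    by (rule bounded_linear_compose[OF bounded_linear_vec_nth R_lin])
  define a where "a = sqrt (1 - p\<^sup>2)"
  have "p\<^sup>2 < 1" using p by (simp add: power_less_one_iff abs_square_less_1)
  then have a: "a > 0" "a\<^sup>2 = 1 - p\<^sup>2" by (auto simp: a_def)
  have third: "R (T s) $ 3 = p" if "s \<in> I" for s
  proof -
    have "R (T s) $ 3 = R (T s) \<bullet> R k" by (simp add: R inner_axis)
    also have "\<dots> = p" using R(1) slope[OF that] by (simp add: orthogonal_transformation_def)
    finally show ?thesis .
  qed
  define x where "x = (\<lambda>s. R (T s) $ 1 / a)"
  define y where "y = (\<lambda>s. R (T s) $ 2 / a)"
  have circle: "(x s)\<^sup>2 + (y s)\<^sup>2 = 1" if "s \<in> I" for s
  proof -
    have "R (T s) \<bullet> R (T s) = 1"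
      using R(1) unit[OF that] by (simp add: orthogonal_transformation_def norm_eq_1)
    then have "(R (T s) $ 1)\<^sup>2 + (R (T s) $ 2)\<^sup>2 = a\<^sup>2"
      by (simp add: inner_vec_def sum_3 third[OF that] a(2)) (simp add: power2_eq_square)
    then show ?thesis
      using a(1) by (simp add: x_def y_def power_divide add_divide_distrib[symmetric])
  qed
  have smooth: "smooth_curve_on I x" "smooth_curve_on I y"
    unfolding x_def y_def
    by (rule smooth_curve_on_linear[OF _ T], rule bounded_linear_compose[OF bounded_linear_divide comp_lin])+
  obtain lam where lam: "smooth_curve_on I lam"
      "\<And>s. s \<in> I \<Longrightarrow> sin (lam s) = x s" "\<And>s. s \<in> I \<Longrightarrow> cos (lam s) = y s"
    using smooth_angle_function[OF I smooth circle] by blast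
  have deriv: "((\<lambda>s. R (\<alpha> s) $ i) has_vector_derivative R (T s) $ i) (at s within I)" if "s \<in> I" for s i
    using bounded_linear.has_vector_derivative[OF comp_lin \<alpha>[OF that]] .
  have XY: "((\<lambda>s. R (\<alpha> s) $ i / a) has_real_derivative R (T s) $ i / a) (at s within I)" if "s \<in> I" for s i
    using deriv[OF that, of i] unfolding has_real_derivative_iff_has_vector_derivative[symmetric]
    by (rule DERIV_cdivide)
  have "((\<lambda>s. R (\<alpha> s) $ 3 - p * s) has_vector_derivative 0) (at s within I)" if "s \<in> I" for s
    using deriv[OF that, of 3] third[OF that]
    unfolding has_real_derivative_iff_has_vector_derivative[symmetric]
    by (auto intro!: derivative_eq_intros)
  from has_vector_derivative_zero_constant[OF is_interval_convex[OF I(1)] this]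
  obtain d where d: "\<And>s. s \<in> I \<Longrightarrow> R (\<alpha> s) $ 3 - p * s = d" by blast
  define A where "A = inv R"
  have A: "orthogonal_transformation A"
    unfolding A_def by (rule orthogonal_transformation_inv[OF R(1)])
  have AR: "A (R v) = v" for v
    unfolding A_def using orthogonal_transformation_inj[OF R(1)] by simp
  have \<alpha>_eq: "\<alpha> s = A (d *\<^sub>R axis 3 1)
      + A (vector [a / 1 * (R (\<alpha> s) $ 1 / a), a / 1 * (R (\<alpha> s) $ 2 / a), p / 1 * s])" if "s \<in> I" for s
  proof -
    have "R (\<alpha> s) = d *\<^sub>R axis 3 1
        + vector [a / 1 * (R (\<alpha> s) $ 1 / a), a / 1 * (R (\<alpha> s) $ 2 / a), p / 1 * s]"
      using d[OF that] a(1) by (simp add: vec_eq_iff forall_3 axis_def)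
    from arg_cong[OF this, of A] show ?thesis
      unfolding AR linear_add[OF orthogonal_transformation_linear[OF A]] .
  qed
  have c: "a\<^sup>2 + p\<^sup>2 = 1\<^sup>2" using a(2) by simp
  have X: "((\<lambda>s. R (\<alpha> s) $ 1 / a) has_real_derivative sin (lam s)) (at s within I)"
    and Y: "((\<lambda>s. R (\<alpha> s) $ 2 / a) has_real_derivative cos (lam s)) (at s within I)" if "s \<in> I" for s
    using XY[OF that] lam(2,3)[OF that] by (simp_all add: x_def y_def)
  show ?thesis
    unfolding cylindrical_helix_def
    by (rule exI[of _ a], rule exI[of _ p], rule exI[of _ 1], rule exI[of _ lam],
        rule exI[of _ "\<lambda>s. R (\<alpha> s) $ 1 / a"], rule exI[of _ "\<lambda>s. R (\<alpha> s) $ 2 / a"],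
        rule exI[of _ A], rule exI[of _ "A (d *\<^sub>R axis 3 1)"],
        intro conjI ballI a(1) p(1) zero_less_one c lam(1) X Y A \<alpha>_eq)
qed

text \<open>The third coefficient of a cylindrical helix is positive, hence a curve that descends in the
  direction \<open>k\<close> is viewed as one that ascends in the direction \<open>- k\<close>.\<close>

lemma constant_slope_imp_cylindrical_helix:
  fixes I :: "real set" and \<alpha> :: "real \<Rightarrow> real^3"
  assumes I: "is_interval I" "\<exists>x\<in>I. \<exists>y\<in>I. x < y"
    and T: "smooth_curve_on I T"
    and \<alpha>: "\<And>s. s \<in> I \<Longrightarrow> (\<alpha> has_vector_derivative T s) (at s within I)"
    and unit: "\<And>s. s \<in> I \<Longrightarrow> norm (T s) = 1"
    and k: "norm k = 1" and p: "p \<noteq> 0" "\<bar>p\<bar> < 1"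
    and slope: "\<And>s. s \<in> I \<Longrightarrow> T s \<bullet> k = p"
  shows "cylindrical_helix I \<alpha>"
proof (cases "p > 0")
  case True
  then show ?thesis
    using constant_slope_positive_imp_cylindrical_helix[OF I T \<alpha> unit k _ _ slope] p by simp
next
  case False
  then show ?thesis
    using constant_slope_positive_imp_cylindrical_helix[OF I T \<alpha> unit, of "- k" "- p"] p k slope
    by simp
qed

section \<open>The moving frame\<close>

lemma orthogonal_expansion_3:
  fixes u v w x :: "real^3"
  assumes "u \<noteq> 0" "v \<noteq> 0" "w \<noteq> 0" and orth: "u \<bullet> v = 0" "u \<bullet> w = 0" "v \<bullet> w = 0"
  shows "x = (u \<bullet> x / (u \<bullet> u)) *\<^sub>R u + (v \<bullet> x / (v \<bullet> v)) *\<^sub>R v + (w \<bullet> x / (w \<bullet> w)) *\<^sub>R w"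
proof -
  let ?S = "{u, v, w}"
  have distinct: "u \<noteq> v" "u \<noteq> w" "v \<noteq> w" using assms by auto
  have pw: "pairwise orthogonal ?S"
    using orth by (auto simp: pairwise_def orthogonal_def inner_commute)
  have "independent ?S"
    using pw assms(1-3) by (intro pairwise_orthogonal_independent) auto
  then have "dim ?S = DIM(real^3)"
    using distinct by (simp add: dim_eq_card_independent)
  then have full: "span ?S = UNIV" by (metis dim_eq_full)
  define d where "d = x - (\<Sum>b\<in>?S. (b \<bullet> x / (b \<bullet> b)) *\<^sub>R b)"
  have "orthogonal d d"
    unfolding d_def by (rule Gram_Schmidt_step[OF pw]) (simp add: full)
  then show ?thesis
    using distinct by (simp add: d_def orthogonal_self add.assoc)
qed

lemma bounded_bilinear_cross3: "bounded_bilinear cross3"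
  using bilinear_cross bilinear_conv_bounded_bilinear by blast

text \<open>The normal field is only assumed to be continuous. But there are just two unit normals at
  each point, so it equals \<open>\<epsilon> C / norm C\<close> with \<open>C = T \<times> U\<close> and a continuous sign \<open>\<epsilon>\<close>, which
  is constant on an interval; therefore it inherits the differentiability of \<open>C\<close>.\<close>

lemma unit_normal_differentiable:
  fixes T U B :: "real \<Rightarrow> real^3"
  assumes I: "is_interval I"
    and T: "\<And>s. s \<in> I \<Longrightarrow> (T has_vector_derivative U s) (at s within I)"
    and U: "\<And>s. s \<in> I \<Longrightarrow> (U has_vector_derivative W s) (at s within I)"
    and T1: "\<And>s. s \<in> I \<Longrightarrow> norm (T s) = 1" and TU: "\<And>s. s \<in> I \<Longrightarrow> T s \<bullet> U s = 0"
    and U0: "\<And>s. s \<in> I \<Longrightarrow> U s \<noteq> 0"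
    and B: "continuous_on I B" and B1: "\<And>s. s \<in> I \<Longrightarrow> norm (B s) = 1"
    and BT: "\<And>s. s \<in> I \<Longrightarrow> B s \<bullet> T s = 0" and BU: "\<And>s. s \<in> I \<Longrightarrow> B s \<bullet> U s = 0"
  obtains B' where "\<And>s. s \<in> I \<Longrightarrow> (B has_vector_derivative B' s) (at s within I)"
proof -
  define C where "C = (\<lambda>s. cross3 (T s) (U s))"
  have C': "(C has_vector_derivative cross3 (T s) (W s) + cross3 (U s) (U s)) (at s within I)"
    if "s \<in> I" for s
    unfolding C_def
    using bounded_bilinear.has_vector_derivative[OF bounded_bilinear_cross3 T[OF that] U[OF that]] .
  have C0: "C s \<noteq> 0" if "s \<in> I" for s
    using norm_cross_dot[of "T s" "U s"] T1[OF that] TU[OF that] U0[OF that] by (auto simp: C_def)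
  define \<epsilon> where "\<epsilon> = (\<lambda>s. C s \<bullet> B s / norm (C s))"
  have B_eq: "B s = (\<epsilon> s / norm (C s)) *\<^sub>R C s" if "s \<in> I" for s
  proof -
    have "B s = (T s \<bullet> B s / (T s \<bullet> T s)) *\<^sub>R T s + (U s \<bullet> B s / (U s \<bullet> U s)) *\<^sub>R U s
        + (C s \<bullet> B s / (C s \<bullet> C s)) *\<^sub>R C s"
      using C0[OF that] T1[OF that] TU[OF that] U0[OF that]
      by (intro orthogonal_expansion_3) (auto simp: C_def dot_cross_self)
    then show ?thesis
      using BT[OF that] BU[OF that]
      by (simp add: inner_commute \<epsilon>_def dot_square_norm power2_eq_square)
  qed
  have \<epsilon>_values: "\<epsilon> s \<in> {1, -1}" if "s \<in> I" for s
    using B1[OF that] C0[OF that] arg_cong[OF B_eq[OF that], of norm] by auto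
  have "continuous_on I C"
    using C' by (metis continuous_on_eq_continuous_within has_vector_derivative_continuous)
  then have "continuous_on I \<epsilon>"
    unfolding \<epsilon>_def using C0 B by (intro continuous_intros) auto
  moreover have "finite (\<epsilon> ` I)"
    by (rule finite_subset[of _ "{1, -1}"]) (use \<epsilon>_values in auto)
  ultimately have "\<epsilon> constant_on I"
    using I by (intro continuous_finite_range_constant) (auto simp: is_interval_connected_1)
  then obtain e where e: "\<And>s. s \<in> I \<Longrightarrow> \<epsilon> s = e" by (auto simp: constant_on_def)
  have "\<exists>b. (B has_vector_derivative b) (at s within I)" if "s \<in> I" for s
  proof -
    have "(\<lambda>s. norm (C s)) differentiable (at s within I)"
      using differentiable_compose[of norm C s I] C0[OF that] C'[OF that]
      by (auto intro: differentiableI_vector)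
    then have "(\<lambda>s. (e / norm (C s)) *\<^sub>R C s) differentiable (at s within I)"
      using C0[OF that] C'[OF that] 
      by (intro differentiable_scaleR differentiable_divide) (auto intro: differentiableI_vector)
    then obtain b where "((\<lambda>s. (e / norm (C s)) *\<^sub>R C s) has_vector_derivative b) (at s within I)"
      by (auto simp: vector_derivative_works)
    then have "(B has_vector_derivative b) (at s within I)"
      by (rule has_vector_derivative_transform[OF that, rotated]) (use B_eq e in auto)
    then show ?thesis ..
  qed
  then show thesis using that by metis
qed

text \<open>The frame \<open>T, U, B\<close> is orthogonal, but \<open>U = T'\<close> is not normalized: its length is the
  curvature. The torsion enters through \<open>m = \<langle>B', U\<rangle>\<close>. Differentiating \<open>\<langle>B, U\<rangle> = 0\<close> gives
  \<open>m = - \<langle>B, W\<rangle>\<close> with \<open>W = U'\<close>, and this form, unlike \<open>\<langle>B', U\<rangle>\<close>, can be differentiated once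
  more although \<open>B\<close> is only known to be differentiable once. That is what is needed to pass from
  \<open>m \<langle>U, k\<rangle> = 0\<close> to \<open>m \<langle>W, k\<rangle> = 0\<close>.

  At a point with \<open>m \<noteq> 0\<close>, both \<open>\<langle>U, k\<rangle>\<close> and \<open>\<langle>W, k\<rangle>\<close> vanish. Then \<open>k\<close> lies in the plane
  of \<open>T\<close> and \<open>B\<close>, and its coordinates \<open>p = \<langle>T, k\<rangle>\<close> and \<open>q\<close> satisfy \<open>p\<^sup>2 + q\<^sup>2 = 1\<close> and
  \<open>p = - q \<mu>\<close>, which determines \<open>\<mu>\<^sup>2\<close> in terms of the constant \<open>q\<close>. So the torsion cannot
  tend to 0 along such points, and the two alternatives do not mix on one interval.\<close>

lemma constant_angle_dichotomy:
  fixes T U W B :: "real \<Rightarrow> real^3" and k :: "real^3"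
  assumes I: "is_interval I" "\<exists>x\<in>I. \<exists>y\<in>I. x < y"
    and T: "\<And>s. s \<in> I \<Longrightarrow> (T has_vector_derivative U s) (at s within I)"
    and U: "\<And>s. s \<in> I \<Longrightarrow> (U has_vector_derivative W s) (at s within I)"
    and B: "\<And>s. s \<in> I \<Longrightarrow> (B has_vector_derivative B' s) (at s within I)"
    and W: "\<And>s. s \<in> I \<Longrightarrow> (W has_vector_derivative W' s) (at s within I)"
    and T1: "\<And>s. s \<in> I \<Longrightarrow> norm (T s) = 1" and TU: "\<And>s. s \<in> I \<Longrightarrow> T s \<bullet> U s = 0"
    and U0: "\<And>s. s \<in> I \<Longrightarrow> U s \<noteq> 0"
    and B1: "\<And>s. s \<in> I \<Longrightarrow> norm (B s) = 1"
    and BT: "\<And>s. s \<in> I \<Longrightarrow> B s \<bullet> T s = 0" and BU: "\<And>s. s \<in> I \<Longrightarrow> B s \<bullet> U s = 0"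
    and k: "norm k = 1" and Bk: "\<And>s. s \<in> I \<Longrightarrow> B s \<bullet> k = q"
  shows "(\<exists>n. \<forall>s\<in>I. B s = n) \<or> (\<exists>p. p \<noteq> 0 \<and> \<bar>p\<bar> < 1 \<and> (\<forall>s\<in>I. T s \<bullet> k = p))"
proof -
  note inner_deriv = bounded_bilinear.has_vector_derivative[OF bounded_bilinear_inner]
  define m where "m = (\<lambda>s. - (B s \<bullet> W s))"
  define \<mu> where "\<mu> = (\<lambda>s. m s / (U s \<bullet> U s))"
  have UU: "U s \<bullet> U s > 0" if "s \<in> I" for s using U0[OF that] by simp
  have m_eq: "B' s \<bullet> U s = m s" if "s \<in> I" for s
    using derivative_of_constant[OF I that inner_deriv[OF B[OF that] U[OF that]] BU]
    by (simp add: m_def)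
  have expand: "x = (T s \<bullet> x) *\<^sub>R T s + (U s \<bullet> x / (U s \<bullet> U s)) *\<^sub>R U s + (B s \<bullet> x) *\<^sub>R B s"
    if "s \<in> I" for s x
  proof -
    have "T s \<noteq> 0" "B s \<noteq> 0" "T s \<bullet> T s = 1" "B s \<bullet> B s = 1"
      using T1[OF that] B1[OF that] by (auto simp: norm_eq_1)
    then show ?thesis
      using orthogonal_expansion_3[of "T s" "U s" "B s" x] U0[OF that] TU[OF that] BT[OF that] BU[OF that]
      by (simp add: inner_commute)
  qed
  have B'_eq: "B' s = \<mu> s *\<^sub>R U s" if "s \<in> I" for s
  proof -
    have "B s \<bullet> B s = 1" if "s \<in> I" for s
      using B1[OF that] by (simp add: norm_eq_1)
    from derivative_of_constant[OF I that inner_deriv[OF B[OF that] B[OF that]] this]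
    have "B s \<bullet> B' s = 0" by (simp add: inner_commute)
    moreover have "T s \<bullet> B' s = 0"
      using derivative_of_constant[OF I that inner_deriv[OF B[OF that] T[OF that]] BT] BU[OF that]
      by (simp add: inner_commute)
    ultimately show ?thesis
      using expand[OF that, of "B' s"] m_eq[OF that] by (simp add: inner_commute \<mu>_def)
  qed
  have mw: "m s * (U s \<bullet> k) = 0" if "s \<in> I" for s
  proof -
    have "B' s \<bullet> k = 0"
      using derivative_of_constant[OF I that
          bounded_linear.has_vector_derivative[OF bounded_linear_inner_left B[OF that]] Bk] by simp
    then show ?thesis using B'_eq[OF that] UU[OF that] by (auto simp: \<mu>_def)
  qed
  have mw': "m s * (W s \<bullet> k) = 0" if "s \<in> I" for s
  proof (cases "m s = 0")
    case False
    have "(m has_vector_derivative - (B s \<bullet> W' s + B' s \<bullet> W s)) (at s within I)"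
      unfolding m_def by (intro has_vector_derivative_minus inner_deriv B W that)
    moreover have "((\<lambda>s. U s \<bullet> k) has_vector_derivative W s \<bullet> k) (at s within I)"
      by (intro bounded_linear.has_vector_derivative[OF bounded_linear_inner_left] U that)
    ultimately have "((\<lambda>s. m s * (U s \<bullet> k)) has_vector_derivative
        m s * (W s \<bullet> k) + (- (B s \<bullet> W' s + B' s \<bullet> W s)) * (U s \<bullet> k)) (at s within I)"
      by (rule has_vector_derivative_mult)
    from derivative_of_constant[OF I that this mw] show ?thesis
      using mw[OF that] False by simp
  qed simp
  have TW: "T s \<bullet> W s = - (U s \<bullet> U s)" if "s \<in> I" for s
    using derivative_of_constant[OF I that inner_deriv[OF T[OF that] U[OF that]] TU] by simp
  have normal_case: "U s \<bullet> k = 0 \<and> T s \<bullet> k = - q * \<mu> s \<and> (T s \<bullet> k)\<^sup>2 + q\<^sup>2 = 1"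
    if "s \<in> I" "m s \<noteq> 0" for s
  proof -
    have w: "U s \<bullet> k = 0" "W s \<bullet> k = 0" using mw mw' that by auto
    have k_eq: "k = (T s \<bullet> k) *\<^sub>R T s + q *\<^sub>R B s"
      using expand[OF that(1), of k] w Bk[OF that(1)] by simp
    have "W s \<bullet> k = (T s \<bullet> k) * (T s \<bullet> W s) + q * (B s \<bullet> W s)"
      by (subst k_eq) (simp add: inner_commute inner_add_right)
    then have "(T s \<bullet> k) * (U s \<bullet> U s) = - q * m s"
      using w TW[OF that(1)] by (simp add: m_def algebra_simps)
    then have "T s \<bullet> k = - q * \<mu> s"
      using UU[OF that(1)] by (simp add: \<mu>_def field_simps)
    moreover have "k \<bullet> k = (T s \<bullet> k)\<^sup>2 + q\<^sup>2"
      by (subst (2) k_eq) (simp add: inner_add_right inner_commute[of k] Bk[OF that(1)] power2_eq_square)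
    ultimately show ?thesis using w k by (simp add: norm_eq_1)
  qed
  have \<mu>_values: "\<mu> s \<in> {0, sqrt (1 / q\<^sup>2 - 1), - sqrt (1 / q\<^sup>2 - 1)}" if "s \<in> I" for s
  proof (cases "m s = 0")
    case False
    from normal_case[OF that False] have eq: "q\<^sup>2 * (\<mu> s)\<^sup>2 + q\<^sup>2 = 1"
      by (metis power_mult_distrib power2_minus mult_minus_left)
    then have "q \<noteq> 0" by auto
    then have "(\<mu> s)\<^sup>2 = 1 / q\<^sup>2 - 1"
      using eq by (simp add: field_simps)
    then have "sqrt (1 / q\<^sup>2 - 1) = \<bar>\<mu> s\<bar>" by (metis real_sqrt_abs)
    then show ?thesis by auto
  qed (simp add: \<mu>_def)
  have "continuous_on I \<mu>"
  proof -
    have "continuous_on I B" "continuous_on I U" "continuous_on I W"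
      using B U W by (metis continuous_on_eq_continuous_within has_vector_derivative_continuous)+
    then show ?thesis
      unfolding \<mu>_def m_def using U0 by (intro continuous_intros) auto
  qed
  moreover have "finite (\<mu> ` I)"
    by (rule finite_subset[of _ "{0, sqrt (1 / q\<^sup>2 - 1), - sqrt (1 / q\<^sup>2 - 1)}"]) (use \<mu>_values in auto)
  ultimately have "\<mu> constant_on I"
    using I by (intro continuous_finite_range_constant) (auto simp: is_interval_connected_1)
  then obtain c where c: "\<And>s. s \<in> I \<Longrightarrow> \<mu> s = c" by (auto simp: constant_on_def)
  show ?thesis
  proof (cases "c = 0")
    case True
    then have "(B has_vector_derivative 0) (at s within I)" if "s \<in> I" for s
      using B[OF that] B'_eq[OF that] c[OF that] by simp
    from has_vector_derivative_zero_constant[OF is_interval_convex[OF I(1)] this]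
    show ?thesis by metis
  next
    case False
    then have m0: "m s \<noteq> 0" if "s \<in> I" for s using c[OF that] by (auto simp: \<mu>_def)
    obtain s0 where s0: "s0 \<in> I" using I(2) by blast
    define p where "p = - q * c"
    have p: "T s \<bullet> k = p" if "s \<in> I" for s
      using normal_case[OF that m0[OF that]] c[OF that] by (simp add: p_def)
    have eq: "p\<^sup>2 + q\<^sup>2 = 1"
      using normal_case[OF s0 m0[OF s0]] unfolding p[OF s0] by blast
    then have "q \<noteq> 0" by (auto simp: p_def)
    then have "p \<noteq> 0" "p\<^sup>2 < 1" using False eq by (auto simp: p_def) (smt (verit) zero_less_power2)
    then show ?thesis using p by (auto simp: abs_square_less_1)
  qed
qed

section \<open>Tangent developables\<close>

theorem theorem1:
  fixes I :: "real set" and \<alpha> :: "real \<Rightarrow> real^3"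
  assumes interval: "is_interval I" and nondegenerate: "\<exists>x\<in>I. \<exists>y\<in>I. x < y"
    and smooth: "smooth_curve_on I \<alpha>"
    and arc_length: "arc_length_param_on I \<alpha>"
    and curvature: "\<forall>s\<in>I. curvature I \<alpha> s \<noteq> 0"
    and not_in_plane:
      "\<not> (\<exists>n d. n \<noteq> 0 \<and> tangent_developable I \<alpha> ` off_edge I \<subseteq> {x. n \<bullet> x = d})"
    and constant_angle: "constant_angle_surface (off_edge I) (tangent_developable I \<alpha>)"
  shows "cylindrical_helix I \<alpha>"
proof -
  note I = interval nondegenerate
  note nonbot = interval_at_within_neq_bot[OF I]
  note inner_deriv = bounded_bilinear.has_vector_derivative[OF bounded_bilinear_inner]
  obtain T where T: "smooth_curve_on I T"
      "\<And>s. s \<in> I \<Longrightarrow> (\<alpha> has_vector_derivative T s) (at s within I)"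
    using smooth_curve_on_derivative[OF smooth] by blast
  obtain U where U: "smooth_curve_on I U"
      "\<And>s. s \<in> I \<Longrightarrow> (T has_vector_derivative U s) (at s within I)"
    using smooth_curve_on_derivative[OF T(1)] by blast
  obtain W where W: "smooth_curve_on I W"
      "\<And>s. s \<in> I \<Longrightarrow> (U has_vector_derivative W s) (at s within I)"
    using smooth_curve_on_derivative[OF U(1)] by blast
  obtain W' where W': "\<And>s. s \<in> I \<Longrightarrow> (W has_vector_derivative W' s) (at s within I)"
    using smooth_curve_on_derivative[OF W(1)] by blast
  have tangent: "tangent_vec I \<alpha> s = T s" if "s \<in> I" for s
    unfolding tangent_vec_def by (rule vector_derivative_within[OF nonbot[OF that] T(2)[OF that]])
  have tangent': "(tangent_vec I \<alpha> has_vector_derivative U s) (at s within I)" if "s \<in> I" for s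
    using that tangent U(2)[OF that] by (rule has_vector_derivative_transform)
  have T1: "norm (T s) = 1" if "s \<in> I" for s
    using arc_length that tangent by (simp add: arc_length_param_on_def)
  have U0: "U s \<noteq> 0" if "s \<in> I" for s
  proof -
    have "curvature I \<alpha> s = norm (U s)"
      unfolding curvature_def by (simp add: vector_derivative_within[OF nonbot tangent'] that)
    then show ?thesis using curvature that by auto
  qed
  have TU: "T s \<bullet> U s = 0" if "s \<in> I" for s
  proof -
    have "T s \<bullet> T s = 1" if "s \<in> I" for s using T1[OF that] by (simp add: norm_eq_1)
    from derivative_of_constant[OF I that inner_deriv[OF U(2)[OF that] U(2)[OF that]] this]
    show ?thesis by (simp add: inner_commute)
  qed
  obtain N k \<theta> where N: "unit_normal_field (off_edge I) (tangent_developable I \<alpha>) N"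
      and k: "norm k = 1" and Nk: "\<And>p. p \<in> off_edge I \<Longrightarrow> N p \<bullet> k = cos \<theta>"
    using constant_angle unfolding constant_angle_surface_def by blast
  define B where "B = (\<lambda>s. N (s, 1))"
  have dom: "(s, 1) \<in> off_edge I" if "s \<in> I" for s using that by (simp add: off_edge_def)
  have "partial_1 (off_edge I) (tangent_developable I \<alpha>) (s, 1) = T s + U s" if "s \<in> I" for s
  proof -
    have "((\<lambda>s. \<alpha> s + 1 *\<^sub>R tangent_vec I \<alpha> s) has_vector_derivative T s + U s) (at s within I)"
      using has_vector_derivative_add[OF T(2)[OF that] tangent'[OF that]] by simp
    from vector_derivative_within[OF nonbot[OF that] this] show ?thesis
      by (simp add: partial_1_def tangent_developable_def off_edge_def)
  qed
  moreover have "partial_2 (off_edge I) (tangent_developable I \<alpha>) (s, 1) = T s" if "s \<in> I" for s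
  proof -
    have "((\<lambda>v. \<alpha> s + v *\<^sub>R T s) has_vector_derivative T s) (at 1)"
      by (auto intro!: derivative_eq_intros)
    moreover have "at (1::real) within {v. v \<noteq> 0} = at 1"
      by (intro at_within_open) (auto simp: open_Collect_neq)
    ultimately show ?thesis
      using that by (simp add: partial_2_def tangent_developable_def off_edge_def tangent vector_derivative_at)
  qed
  ultimately have BT: "B s \<bullet> T s = 0" and BTU: "B s \<bullet> (T s + U s) = 0" and B1: "norm (B s) = 1"
    if "s \<in> I" for s
    using N dom[OF that] that unfolding unit_normal_field_def B_def by auto
  have BU: "B s \<bullet> U s = 0" if "s \<in> I" for s
    using BT[OF that] BTU[OF that] by (simp add: inner_add_right)
  have "continuous_on I B"
    unfolding B_def
  proof (rule continuous_on_compose2[of "off_edge I" N])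
    show "continuous_on (off_edge I) N" using N by (simp add: unit_normal_field_def)
  qed (auto intro!: continuous_intros simp: dom)
  from unit_normal_differentiable[OF interval U(2) W(2) T1 TU U0 this B1 BT BU]
  obtain B' where B': "\<And>s. s \<in> I \<Longrightarrow> (B has_vector_derivative B' s) (at s within I)" by blast
  have Bk: "B s \<bullet> k = cos \<theta>" if "s \<in> I" for s
    unfolding B_def by (rule Nk[OF dom[OF that]])
  from constant_angle_dichotomy[OF I U(2) W(2) B' W' T1 TU U0 B1 BT BU k Bk]
  show ?thesis
  proof
    assume "\<exists>n. \<forall>s\<in>I. B s = n"
    then obtain n where n: "\<And>s. s \<in> I \<Longrightarrow> B s = n" by blast
    have nT: "n \<bullet> T s = 0" if "s \<in> I" for s using BT[OF that] n[OF that] by simp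
    have "((\<lambda>s. n \<bullet> \<alpha> s) has_vector_derivative 0) (at s within I)" if "s \<in> I" for s
      using bounded_linear.has_vector_derivative[OF bounded_linear_inner_right T(2)[OF that], of n]
      by (simp add: nT[OF that])
    from has_vector_derivative_zero_constant[OF is_interval_convex[OF interval] this]
    obtain d where d: "\<And>s. s \<in> I \<Longrightarrow> n \<bullet> \<alpha> s = d" by blast
    have "tangent_developable I \<alpha> ` off_edge I \<subseteq> {x. n \<bullet> x = d}"
      by (auto simp: tangent_developable_def off_edge_def tangent inner_add_right nT d)
    moreover have "n \<noteq> 0" using B1 n nondegenerate by force
    ultimately show ?thesis using not_in_plane by blast
  next
    assume "\<exists>p. p \<noteq> 0 \<and> \<bar>p\<bar> < 1 \<and> (\<forall>s\<in>I. T s \<bullet> k = p)"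
    then obtain p where "p \<noteq> 0" "\<bar>p\<bar> < 1" "\<And>s. s \<in> I \<Longrightarrow> T s \<bullet> k = p" by blast
    then show ?thesis
      by (intro constant_slope_imp_cylindrical_helix[OF I T T1 k])
  qed
qed

end
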